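(* Let $P$ be a finite set of atomic propositions, $T\in\mathbb{N}$, $\mathbb{T}=\{0,\dots,T\}$, $x:\mathbb{T}\to 2^P$ a discrete-time signal, and $\varphi$ an MTL formula in positive normal form (with closed intervals $[a,b]$, $a,b\in\mathbb{N}$, $a\le b$). Then for every $i\in\mathbb{T}$: $(x,i)\models\varphi \iff \llbracket x,\varphi\rrbracket[i]>0$, and $(x,i)\not\models\varphi\iff\llbracket x,\varphi\rrbracket[i]=0$.
   Context: $x_p[i]=1$ if $p\in x[i]$, else $0$. Positive normal form formulas: $\varphi::=p\mid\neg p\mid\varphi\vee\psi\mid\varphi\wedge\psi\mid F_I\varphi\mid G_I\varphi\mid P_I\varphi\mid H_I\varphi\mid\varphi U_I\psi\mid\varphi S_I\psi$. Classical semantics $\models$: $(x,i)\models p$ iff $x_p[i]=1$; $\neg p,\vee,\wedge$ as usual; $F_I\varphi$: $\exists j\in(i+I)\cap\mathbb{T}$ with $(x,j)\models\varphi$; $G_I\varphi$: $\forall j\in(i+I)\cap\mathbb{T}$; $P_I\varphi$: $\exists j\in(i-I)\cap\mathbb{T}$; $H_I\varphi$: $\forall j\in(i-I)\cap\mathbb{T}$; $\varphi U_I\psi$: $\exists j\in(i+I)\cap\mathbb{T}$ with $(x,j)\models\psi$ and $(x,k)\models\varphi$ for all integers $i<k<j$; $\varphi S_I\psi$: $\exists j\in(i-I)\cap\mathbb{T}$ with $(x,j)\models\psi$ and $(x,k)\models\varphi$ for all integers $j<k<i$. Quantitative semantics (real values): for a closed integer interval $I$ with $|I|$ its number of integer points,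 $\delta$ the Kronecker delta, $w^+_I[t]=\frac{1}{|I|}\sum_{k\in I}\delta(t+k)$, $w^-_I[t]=\frac1{|I|}\sum_{k\in I}\delta(t-k)$. Then $\llbracket x,p\rrbracket[i]=x_p[i]$; $\llbracket x,\neg p\rrbracket[i]=1-x_p[i]$; $\llbracket x,\varphi\vee\psi\rrbracket=\max$, $\llbracket x,\varphi\wedge\psi\rrbracket=\min$ (pointwise); $\llbracket x,F_I\varphi\rrbracket[i]=\sum_{j\in\mathbb{T}}\llbracket x,\varphi\rrbracket[j]\,w^+_I[i-j]$; $\llbracket x,P_I\varphi\rrbracket[i]=\sum_{j\in\mathbb{T}}\llbracket x,\varphi\rrbracket[j]\,w^-_I[i-j]$; $\llbracket x,G_I\varphi\rrbracket[i]=\min_{j\in(i+I)\cap\mathbb{T}}\llbracket x,\varphi\rrbracket[j]$; $\llbracket x,H_I\varphi\rrbracket[i]=\min_{j\in(i-I)\cap\mathbb{T}}\llbracket x,\varphi\rrbracket[j]$ (minimum over the empty set is $1$); $\llbracket x,\varphi U_I\psi\rrbracket[i]=\frac1{|I|}\sum_{j\in I}\llbracket x,G_{[1,j-1]}\varphi\rrbracket[i]\cdot\llbracket x,F_{[j,j]}\psi\rrbracket[i]$; $\llbracket x,\varphi S_I\psi\rrbracket[i]=\frac1{|I|}\sum_{j\in I}\llbracket x,H_{[1,j-1]}\varphi\rrbracket[i]\cdot\llbracket x,P_{[j,j]}\psi\rrbracket[i]$, where $[1,j-1]$ is empty when $j\le 1$. *)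

theory Defs
  imports Complex_Main
begin

text \<open>
  Time points and interval elements are integers, so that \<open>i - I\<close> is literal; an interval
  \<open>[a,b]\<close> occurring in a formula is the pair \<open>(a, b)\<close> of natural numbers.
\<close>

datatype 'a mtl =
    Prop 'a
  | NProp 'a
  | Or "'a mtl" "'a mtl"
  | And "'a mtl" "'a mtl"
  | Finally "nat \<times> nat" "'a mtl"
  | Globally "nat \<times> nat" "'a mtl"
  | Past "nat \<times> nat" "'a mtl"
  | Historically "nat \<times> nat" "'a mtl"
  | Until "'a mtl" "nat \<times> nat" "'a mtl"
  | Since "'a mtl" "nat \<times> nat" "'a mtl"

primrec mtl_over :: "'a set \<Rightarrow> 'a mtl \<Rightarrow> bool" where
  "mtl_over P (Prop p) \<longleftrightarrow> p \<in> P"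
| "mtl_over P (NProp p) \<longleftrightarrow> p \<in> P"
| "mtl_over P (Or \<phi> \<psi>) \<longleftrightarrow> mtl_over P \<phi> \<and> mtl_over P \<psi>"
| "mtl_over P (And \<phi> \<psi>) \<longleftrightarrow> mtl_over P \<phi> \<and> mtl_over P \<psi>"
| "mtl_over P (Finally I \<phi>) \<longleftrightarrow> fst I \<le> snd I \<and> mtl_over P \<phi>"
| "mtl_over P (Globally I \<phi>) \<longleftrightarrow> fst I \<le> snd I \<and> mtl_over P \<phi>"
| "mtl_over P (Past I \<phi>) \<longleftrightarrow> fst I \<le> snd I \<and> mtl_over P \<phi>"
| "mtl_over P (Historically I \<phi>) \<longleftrightarrow> fst I \<le> snd I \<and> mtl_over P \<phi>"
| "mtl_over P (Until \<phi> I \<psi>) \<longleftrightarrow> fst I \<le> snd I \<and> mtl_over P \<phi> \<and> mtl_over P \<psi>"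
| "mtl_over P (Since \<phi> I \<psi>) \<longleftrightarrow> fst I \<le> snd I \<and> mtl_over P \<phi> \<and> mtl_over P \<psi>"

definition time_dom :: "nat \<Rightarrow> int set" where
  "time_dom T = {0..int T}"

definition ival :: "nat \<times> nat \<Rightarrow> int set" where
  "ival I = {int (fst I)..int (snd I)}"

definition shift_fwd :: "int \<Rightarrow> int set \<Rightarrow> int set" where
  "shift_fwd i I = (\<lambda>k. i + k) ` I"

definition shift_bwd :: "int \<Rightarrow> int set \<Rightarrow> int set" where
  "shift_bwd i I = (\<lambda>k. i - k) ` I"

definition prop_val :: "(int \<Rightarrow> 'a set) \<Rightarrow> 'a \<Rightarrow> int \<Rightarrow> real" where
  "prop_val x p i = (if p \<in> x i then 1 else 0)"

primrec sat :: "nat \<Rightarrow> (int \<Rightarrow> 'a set) \<Rightarrow> int \<Rightarrow> 'a mtl \<Rightarrow> bool" where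
  "sat T x i (Prop p) \<longleftrightarrow> prop_val x p i = 1"
| "sat T x i (NProp p) \<longleftrightarrow> \<not> prop_val x p i = 1"
| "sat T x i (Or \<phi> \<psi>) \<longleftrightarrow> sat T x i \<phi> \<or> sat T x i \<psi>"
| "sat T x i (And \<phi> \<psi>) \<longleftrightarrow> sat T x i \<phi> \<and> sat T x i \<psi>"
| "sat T x i (Finally I \<phi>) \<longleftrightarrow> (\<exists>j \<in> shift_fwd i (ival I) \<inter> time_dom T. sat T x j \<phi>)"
| "sat T x i (Globally I \<phi>) \<longleftrightarrow> (\<forall>j \<in> shift_fwd i (ival I) \<inter> time_dom T. sat T x j \<phi>)"
| "sat T x i (Past I \<phi>) \<longleftrightarrow> (\<exists>j \<in> shift_bwd i (ival I) \<inter> time_dom T. sat T x j \<phi>)"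
| "sat T x i (Historically I \<phi>) \<longleftrightarrow> (\<forall>j \<in> shift_bwd i (ival I) \<inter> time_dom T. sat T x j \<phi>)"
| "sat T x i (Until \<phi> I \<psi>) \<longleftrightarrow>
     (\<exists>j \<in> shift_fwd i (ival I) \<inter> time_dom T.
        sat T x j \<psi> \<and> (\<forall>k. i < k \<and> k < j \<longrightarrow> sat T x k \<phi>))"
| "sat T x i (Since \<phi> I \<psi>) \<longleftrightarrow>
     (\<exists>j \<in> shift_bwd i (ival I) \<inter> time_dom T.
        sat T x j \<psi> \<and> (\<forall>k. j < k \<and> k < i \<longrightarrow> sat T x k \<phi>))"

definition kdelta :: "int \<Rightarrow> real" where
  "kdelta t = (if t = 0 then 1 else 0)"

definition w_plus :: "int set \<Rightarrow> int \<Rightarrow> real" where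
  "w_plus I t = 1 / real (card I) * (\<Sum>k\<in>I. kdelta (t + k))"

definition w_minus :: "int set \<Rightarrow> int \<Rightarrow> real" where
  "w_minus I t = 1 / real (card I) * (\<Sum>k\<in>I. kdelta (t - k))"

definition min_over :: "int set \<Rightarrow> (int \<Rightarrow> real) \<Rightarrow> real" where
  "min_over A f = (if A = {} then 1 else Min (f ` A))"

text \<open>
  The quantitative temporal operators act on the real-valued signal \<open>f\<close> of the subformula and
  take the interval as a set, because until and since apply them to \<open>[1, j - 1]\<close> (possibly
  empty) and \<open>[j, j]\<close>, which makes the recursion on formulas non-structural otherwise.
\<close>

definition q_finally :: "nat \<Rightarrow> int set \<Rightarrow> (int \<Rightarrow> real) \<Rightarrow> int \<Rightarrow> real" where
  "q_finally T I f i = (\<Sum>j\<in>time_dom T. f j * w_plus I (i - j))"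

definition q_past :: "nat \<Rightarrow> int set \<Rightarrow> (int \<Rightarrow> real) \<Rightarrow> int \<Rightarrow> real" where
  "q_past T I f i = (\<Sum>j\<in>time_dom T. f j * w_minus I (i - j))"

definition q_globally :: "nat \<Rightarrow> int set \<Rightarrow> (int \<Rightarrow> real) \<Rightarrow> int \<Rightarrow> real" where
  "q_globally T I f i = min_over (shift_fwd i I \<inter> time_dom T) f"

definition q_historically :: "nat \<Rightarrow> int set \<Rightarrow> (int \<Rightarrow> real) \<Rightarrow> int \<Rightarrow> real" where
  "q_historically T I f i = min_over (shift_bwd i I \<inter> time_dom T) f"

primrec quant :: "nat \<Rightarrow> (int \<Rightarrow> 'a set) \<Rightarrow> 'a mtl \<Rightarrow> int \<Rightarrow> real" where
  "quant T x (Prop p) = (\<lambda>i. prop_val x p i)"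
| "quant T x (NProp p) = (\<lambda>i. 1 - prop_val x p i)"
| "quant T x (Or \<phi> \<psi>) = (\<lambda>i. max (quant T x \<phi> i) (quant T x \<psi> i))"
| "quant T x (And \<phi> \<psi>) = (\<lambda>i. min (quant T x \<phi> i) (quant T x \<psi> i))"
| "quant T x (Finally I \<phi>) = q_finally T (ival I) (quant T x \<phi>)"
| "quant T x (Globally I \<phi>) = q_globally T (ival I) (quant T x \<phi>)"
| "quant T x (Past I \<phi>) = q_past T (ival I) (quant T x \<phi>)"
| "quant T x (Historically I \<phi>) = q_historically T (ival I) (quant T x \<phi>)"
| "quant T x (Until \<phi> I \<psi>) = (\<lambda>i. 1 / real (card (ival I)) *
     (\<Sum>j\<in>ival I. q_globally T {1..j - 1} (quant T x \<phi>) i * q_finally T {j..j} (quant T x \<psi>) i))"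
| "quant T x (Since \<phi> I \<psi>) = (\<lambda>i. 1 / real (card (ival I)) *
     (\<Sum>j\<in>ival I. q_historically T {1..j - 1} (quant T x \<phi>) i * q_past T {j..j} (quant T x \<psi>) i))"

end

theory Submission imports Defs begin

text \<open>
  By induction on the formula, every value on the time domain is nonnegative, and it is positive
  exactly where the formula holds. Averages with nonnegative weights of full support are positive
  iff some term is, which matches the existential operators; minima are positive iff all terms are,
  which matches the universal ones. In until and since, the points strictly between two elements of
  the time domain lie in the time domain again, so restricting the minimum to it loses nothing.
\<close>

text \<open>A finite sum of nonnegative terms vanishes only if every term does, so nothing can
  cancel a positive term.\<close>

lemma sum_pos_iff_ex_pos:
  fixes f :: "'b \<Rightarrow> 'c::ordered_comm_monoid_add"
  assumes "finite A" "\<And>a. a \<in> A \<Longrightarrow> 0 \<le> f a"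
  shows "0 < sum f A \<longleftrightarrow> (\<exists>a\<in>A. 0 < f a)"
  using assms sum_nonneg[of A f] sum_nonneg_eq_0_iff[of A f] by (force simp: less_le)

lemma mult_pos_iff_nonneg:
  fixes a b :: real
  assumes "0 \<le> a" "0 \<le> b"
  shows "0 < a * b \<longleftrightarrow> 0 < a \<and> 0 < b"
  using assms by (auto simp: zero_less_mult_iff)

lemma mem_shift_fwd: "j \<in> shift_fwd i I \<longleftrightarrow> j - i \<in> I"
  by (force simp: shift_fwd_def image_iff)

lemma mem_shift_bwd: "j \<in> shift_bwd i I \<longleftrightarrow> i - j \<in> I"
  by (force simp: shift_bwd_def image_iff)

lemma finite_time_dom: "finite (time_dom T)"
  by (simp add: time_dom_def)

lemma finite_ival: "finite (ival I)"
  by (simp add: ival_def)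

text \<open>The only \<open>k\<close> with a nonzero delta is \<open>- t\<close>. At
  \<open>t = i - j\<close> the condition reads \<open>j - i \<in> I\<close>, so the kernel is the
  uniform weight on \<open>i + I\<close>.\<close>

lemma w_plus_eq:
  assumes "finite I"
  shows "w_plus I t = (if - t \<in> I then 1 / real (card I) else 0)"
proof -
  have "(\<Sum>k\<in>I. kdelta (t + k)) = (\<Sum>k\<in>I. if k = - t then 1 else 0)"
    by (rule sum.cong) (auto simp: kdelta_def)
  then show ?thesis using assms by (simp add: w_plus_def)
qed

lemma w_minus_eq:
  assumes "finite I"
  shows "w_minus I t = (if t \<in> I then 1 / real (card I) else 0)"
proof -
  have "(\<Sum>k\<in>I. kdelta (t - k)) = (\<Sum>k\<in>I. if k = t then 1 else 0)"
    by (rule sum.cong) (auto simp: kdelta_def)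
  then show ?thesis using assms by (simp add: w_minus_def)
qed

lemma q_finally_nonneg:
  assumes "finite I" "\<And>j. j \<in> time_dom T \<Longrightarrow> 0 \<le> f j"
  shows "0 \<le> q_finally T I f i"
  unfolding q_finally_def using assms by (intro sum_nonneg) (simp add: w_plus_eq)

lemma q_finally_pos_iff:
  assumes "finite I" "\<And>j. j \<in> time_dom T \<Longrightarrow> 0 \<le> f j"
  shows "0 < q_finally T I f i \<longleftrightarrow> (\<exists>j\<in>shift_fwd i I \<inter> time_dom T. 0 < f j)"
proof -
  have "0 < q_finally T I f i \<longleftrightarrow> (\<exists>j\<in>time_dom T. 0 < f j * w_plus I (i - j))"
    unfolding q_finally_def using assms
    by (intro sum_pos_iff_ex_pos finite_time_dom) (simp add: w_plus_eq)
  also have "\<dots> \<longleftrightarrow> (\<exists>j\<in>shift_fwd i I \<inter> time_dom T. 0 < f j)"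
    \<comment> \<open>A nonzero weight puts \<open>j - i\<close> into \<open>I\<close>, so
      \<open>I\<close> is nonempty and \<open>1 / real (card I)\<close> is positive. For empty
      \<open>I\<close> both sides are false.\<close>
    using assms(1)
    by (auto simp: w_plus_eq mem_shift_fwd zero_less_divide_iff card_gt_0_iff split: if_splits)
  finally show ?thesis .
qed

lemma q_past_nonneg:
  assumes "finite I" "\<And>j. j \<in> time_dom T \<Longrightarrow> 0 \<le> f j"
  shows "0 \<le> q_past T I f i"
  unfolding q_past_def using assms by (intro sum_nonneg) (simp add: w_minus_eq)

lemma q_past_pos_iff:
  assumes "finite I" "\<And>j. j \<in> time_dom T \<Longrightarrow> 0 \<le> f j"
  shows "0 < q_past T I f i \<longleftrightarrow> (\<exists>j\<in>shift_bwd i I \<inter> time_dom T. 0 < f j)"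
proof -
  have "0 < q_past T I f i \<longleftrightarrow> (\<exists>j\<in>time_dom T. 0 < f j * w_minus I (i - j))"
    unfolding q_past_def using assms
    by (intro sum_pos_iff_ex_pos finite_time_dom) (simp add: w_minus_eq)
  also have "\<dots> \<longleftrightarrow> (\<exists>j\<in>shift_bwd i I \<inter> time_dom T. 0 < f j)"
    using assms(1)
    by (auto simp: w_minus_eq mem_shift_bwd zero_less_divide_iff card_gt_0_iff split: if_splits)
  finally show ?thesis .
qed

lemma min_over_nonneg:
  assumes "finite A" "\<And>j. j \<in> A \<Longrightarrow> 0 \<le> f j"
  shows "0 \<le> min_over A f"
  using assms by (simp add: min_over_def)

text \<open>The default value 1 on the empty set is positive, in agreement with the vacuously true
  right-hand side.\<close>

lemma min_over_pos_iff:
  assumes "finite A"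
  shows "0 < min_over A f \<longleftrightarrow> (\<forall>j\<in>A. 0 < f j)"
  using assms by (simp add: min_over_def)

lemma q_globally_nonneg:
  assumes "\<And>j. j \<in> time_dom T \<Longrightarrow> 0 \<le> f j"
  shows "0 \<le> q_globally T I f i"
  unfolding q_globally_def using assms by (intro min_over_nonneg) (auto simp: finite_time_dom)

lemma q_globally_pos_iff:
  "0 < q_globally T I f i \<longleftrightarrow> (\<forall>j\<in>shift_fwd i I \<inter> time_dom T. 0 < f j)"
  by (simp add: q_globally_def min_over_pos_iff finite_time_dom)

lemma q_historically_nonneg:
  assumes "\<And>j. j \<in> time_dom T \<Longrightarrow> 0 \<le> f j"
  shows "0 \<le> q_historically T I f i"
  unfolding q_historically_def using assms by (intro min_over_nonneg) (auto simp: finite_time_dom)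

lemma q_historically_pos_iff:
  "0 < q_historically T I f i \<longleftrightarrow> (\<forall>j\<in>shift_bwd i I \<inter> time_dom T. 0 < f j)"
  by (simp add: q_historically_def min_over_pos_iff finite_time_dom)

text \<open>Common shape of the until and since values: \<open>f\<close> carries the invariant part
  and \<open>g\<close> the target part of each offset.\<close>

lemma average_products_pos_iff:
  fixes f g :: "'b \<Rightarrow> real"
  assumes "finite A" "\<And>a. a \<in> A \<Longrightarrow> 0 \<le> f a" "\<And>a. a \<in> A \<Longrightarrow> 0 \<le> g a"
  shows "0 < 1 / real (card A) * (\<Sum>a\<in>A. f a * g a) \<longleftrightarrow> (\<exists>a\<in>A. 0 < f a \<and> 0 < g a)"
proof (cases "A = {}")
  case False
  with assms(1) have "0 < 1 / real (card A)" by (simp add: card_gt_0_iff)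
  then have "0 < 1 / real (card A) * (\<Sum>a\<in>A. f a * g a) \<longleftrightarrow> 0 < (\<Sum>a\<in>A. f a * g a)"
    by (simp only: zero_less_mult_iff) auto
  also have "\<dots> \<longleftrightarrow> (\<exists>a\<in>A. 0 < f a * g a)"
    using assms by (intro sum_pos_iff_ex_pos) auto
  finally show ?thesis using assms by (simp add: mult_pos_iff_nonneg)
\<comment> \<open>For empty \<open>A\<close> the sum is 0 and there is no witness, so both sides are
  false.\<close>
qed simp

lemma q_until_pos_iff:
  assumes "finite I" "i \<in> time_dom T"
    and f: "\<And>j. j \<in> time_dom T \<Longrightarrow> 0 \<le> f j" and g: "\<And>j. j \<in> time_dom T \<Longrightarrow> 0 \<le> g j"
  shows "0 < 1 / real (card I) * (\<Sum>j\<in>I. q_globally T {1..j - 1} f i * q_finally T {j..j} g i)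
    \<longleftrightarrow> (\<exists>j\<in>shift_fwd i I \<inter> time_dom T. 0 < g j \<and> (\<forall>k. i < k \<and> k < j \<longrightarrow> 0 < f k))"
    (is "?L \<longleftrightarrow> ?R")
proof -
  have "?L \<longleftrightarrow> (\<exists>j\<in>I. 0 < q_globally T {1..j - 1} f i \<and> 0 < q_finally T {j..j} g i)"
    using assms by (intro average_products_pos_iff q_globally_nonneg q_finally_nonneg) auto
  \<comment> \<open>The window \<open>{j..j}\<close> sees the single point \<open>i + j\<close>, and
    its value is 0 when that point leaves the time domain.\<close>
  also have "\<dots> \<longleftrightarrow> (\<exists>j\<in>I. (\<forall>k\<in>shift_fwd i {1..j - 1} \<inter> time_dom T. 0 < f k)
      \<and> i + j \<in> time_dom T \<and> 0 < g (i + j))"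
    using g by (simp add: q_globally_pos_iff q_finally_pos_iff) (auto simp: shift_fwd_def)
  \<comment> \<open>The offsets \<open>1\<close> to \<open>j - 1\<close> are exactly the points
    strictly between \<open>i\<close> and \<open>i + j\<close>. For \<open>j \<le> 1\<close> both
    ranges are empty.\<close>
  also have "\<dots> \<longleftrightarrow> (\<exists>j\<in>I. i + j \<in> time_dom T \<and> 0 < g (i + j)
      \<and> (\<forall>k. i < k \<and> k < i + j \<longrightarrow> 0 < f k))"
    using assms(2) by (intro bex_cong refl) (auto simp: mem_shift_fwd time_dom_def)
  also have "\<dots> \<longleftrightarrow> ?R"
    by (auto simp: shift_fwd_def)
  finally show ?thesis .
qed

text \<open>Time reversal of \<open>q_until_pos_iff\<close>: offsets are subtracted, so
  \<open>1\<close> to \<open>j - 1\<close> yield the points strictly between \<open>i - j\<close>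
  and \<open>i\<close>.\<close>

lemma q_since_pos_iff:
  assumes "finite I" "i \<in> time_dom T"
    and f: "\<And>j. j \<in> time_dom T \<Longrightarrow> 0 \<le> f j" and g: "\<And>j. j \<in> time_dom T \<Longrightarrow> 0 \<le> g j"
  shows "0 < 1 / real (card I) * (\<Sum>j\<in>I. q_historically T {1..j - 1} f i * q_past T {j..j} g i)
    \<longleftrightarrow> (\<exists>j\<in>shift_bwd i I \<inter> time_dom T. 0 < g j \<and> (\<forall>k. j < k \<and> k < i \<longrightarrow> 0 < f k))"
    (is "?L \<longleftrightarrow> ?R")
proof -
  have "?L \<longleftrightarrow> (\<exists>j\<in>I. 0 < q_historically T {1..j - 1} f i \<and> 0 < q_past T {j..j} g i)"
    using assms by (intro average_products_pos_iff q_historically_nonneg q_past_nonneg) auto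
  also have "\<dots> \<longleftrightarrow> (\<exists>j\<in>I. (\<forall>k\<in>shift_bwd i {1..j - 1} \<inter> time_dom T. 0 < f k)
      \<and> i - j \<in> time_dom T \<and> 0 < g (i - j))"
    using g by (simp add: q_historically_pos_iff q_past_pos_iff) (auto simp: shift_bwd_def)
  also have "\<dots> \<longleftrightarrow> (\<exists>j\<in>I. i - j \<in> time_dom T \<and> 0 < g (i - j)
      \<and> (\<forall>k. i - j < k \<and> k < i \<longrightarrow> 0 < f k))"
    using assms(2) by (intro bex_cong refl) (auto simp: mem_shift_bwd time_dom_def)
  also have "\<dots> \<longleftrightarrow> ?R"
    by (auto simp: shift_bwd_def)
  finally show ?thesis .
qed

text \<open>Supplies the sign hypotheses of the positivity criteria, and later turns a value that is
  not positive into 0.\<close>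

lemma quant_nonneg:
  "i \<in> time_dom T \<Longrightarrow> 0 \<le> quant T x \<phi> i"
  by (induction \<phi> arbitrary: i)
    (auto simp: prop_val_def finite_ival q_globally_nonneg q_historically_nonneg q_finally_nonneg
      q_past_nonneg le_max_iff_disj intro!: divide_nonneg_nonneg sum_nonneg mult_nonneg_nonneg)

text \<open>The point \<open>i\<close> is generalised because the temporal operators evaluate their
  arguments at other points of the time domain.\<close>

lemma sat_iff_quant_pos:
  "i \<in> time_dom T \<Longrightarrow> sat T x i \<phi> \<longleftrightarrow> 0 < quant T x \<phi> i"
proof (induction \<phi> arbitrary: i)
  case (Until \<phi> I \<psi>)
  have "sat T x i (Until \<phi> I \<psi>) \<longleftrightarrow> (\<exists>j\<in>shift_fwd i (ival I) \<inter> time_dom T.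
      0 < quant T x \<psi> j \<and> (\<forall>k. i < k \<and> k < j \<longrightarrow> 0 < quant T x \<phi> k))"
    \<comment> \<open>The induction hypothesis for \<open>\<phi>\<close> is available at each
      \<open>k\<close>, since \<open>i\<close> and \<open>j\<close> lie in the time domain and it is
      an integer interval.\<close>
    unfolding sat.simps using Until by (intro bex_cong refl) (auto simp: time_dom_def)
  also have "\<dots> \<longleftrightarrow> 0 < quant T x (Until \<phi> I \<psi>) i"
    unfolding quant.simps using Until.prems
    by (intro q_until_pos_iff[symmetric] finite_ival quant_nonneg)
  finally show ?case .
next
  case (Since \<phi> I \<psi>)
  have "sat T x i (Since \<phi> I \<psi>) \<longleftrightarrow> (\<exists>j\<in>shift_bwd i (ival I) \<inter> time_dom T.
      0 < quant T x \<psi> j \<and> (\<forall>k. j < k \<and> k < i \<longrightarrow> 0 < quant T x \<phi> k))"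
    unfolding sat.simps using Since by (intro bex_cong refl) (auto simp: time_dom_def)
  also have "\<dots> \<longleftrightarrow> 0 < quant T x (Since \<phi> I \<psi>) i"
    unfolding quant.simps using Since.prems
    by (intro q_since_pos_iff[symmetric] finite_ival quant_nonneg)
  finally show ?case .
qed (auto simp: prop_val_def finite_ival quant_nonneg q_finally_pos_iff q_past_pos_iff
    q_globally_pos_iff q_historically_pos_iff less_max_iff_disj)

theorem theorem3:
  fixes P :: "'a set" and T :: nat and x :: "int \<Rightarrow> 'a set" and \<phi> :: "'a mtl" and i :: int
  assumes "finite P"
    and "\<And>t. t \<in> time_dom T \<Longrightarrow> x t \<subseteq> P"
    and "mtl_over P \<phi>"
    and "i \<in> time_dom T"
  shows "(sat T x i \<phi> \<longleftrightarrow> quant T x \<phi> i > 0) \<and> (\<not> sat T x i \<phi> \<longleftrightarrow> quant T x \<phi> i = 0)"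
  \<comment> \<open>The second equivalence negates the first: a nonnegative value fails to be
    positive exactly when it is 0.\<close>
  using assms(4) sat_iff_quant_pos[of i T x \<phi>] quant_nonneg[of i T x \<phi>] by auto

end
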